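(* Let $T=\{2341,1243,1234\}$ and let $F_T(x)=\sum_{n\ge0}|S_n(T)|x^n$. Then $$F_T(x)=\frac{x(4x^4+3x^3-11x^2+6x-1)C(x)+2x^4-12x^3+16x^2-7x+1}{(1-2x)^2\big(1-4x+2x^2-x(1-3x)C(x)\big)},$$ where $C(x)=\frac{1-\sqrt{1-4x}}{2x}$.
   Context: $S_n$ is the set of permutations of $[n]$ ($S_0$ contains the empty permutation). A permutation avoids a pattern $\tau$ if it has no subsequence order-isomorphic to $\tau$; $S_n(T)$ is the set of permutations in $S_n$ avoiding every pattern in $T$. $C(x)$ is the Catalan generating function. *)

theory Defs
  imports
    Complex_Main
    "HOL-Library.Sublist"
    "HOL-Combinatorics.Multiset_Permutations"
    "HOL-Computational_Algebra.Formal_Power_Series"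
begin

text \<open>
  Permutations are written in one-line notation: the elements of \<open>S\<^sub>n\<close> are the words in
  \<^term>\<open>permutations_of_set {1..n}\<close>, with only the empty word for \<open>n = 0\<close>.
\<close>

definition order_isomorphic :: "nat list \<Rightarrow> nat list \<Rightarrow> bool" where
  "order_isomorphic xs ys \<longleftrightarrow>
     length xs = length ys \<and>
     (\<forall>i < length xs. \<forall>j < length xs. xs ! i < xs ! j \<longleftrightarrow> ys ! i < ys ! j)"

definition avoids :: "nat list \<Rightarrow> nat list \<Rightarrow> bool" where
  "avoids \<sigma> \<tau> \<longleftrightarrow> \<not> (\<exists>xs. subseq xs \<sigma> \<and> order_isomorphic xs \<tau>)"

definition avoiders :: "nat list set \<Rightarrow> nat \<Rightarrow> nat list set" where
  "avoiders T n = {\<sigma> \<in> permutations_of_set {1..n}. \<forall>\<tau> \<in> T. avoids \<sigma> \<tau>}"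

definition avoiders_gf :: "nat list set \<Rightarrow> real fps" where
  "avoiders_gf T = Abs_fps (\<lambda>n. of_nat (card (avoiders T n)))"

text \<open>
  The term \<^term>\<open>fps_radical root 2 (1 - 4 * fps_X) :: real fps\<close> is the formal square root of
  \<open>1 - 4x\<close> with constant coefficient \<open>1\<close>. One minus it has constant coefficient \<open>0\<close>, so
  the division by \<open>2x\<close> is exact.
\<close>

definition catalan_gf :: "real fps" where
  "catalan_gf = (1 - fps_radical root 2 (1 - 4 * fps_X)) / (2 * fps_X)"

end

theory Submission
  imports Defs
begin

text \<open>
  Permutations are built by prepending letters. Call \<open>a\<close> a site of \<open>\<pi> \<in> S\<^sub>n(T)\<close> if prepending
  \<open>a\<close> (and raising the letters \<open>\<ge> a\<close> by one) creates no pattern of \<open>T\<close>. The largest two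
  values \<open>n + 1\<close> and \<open>n\<close> are always sites. Prepending the maximum keeps all sites and adds one;
  prepending the second largest letter keeps, apart from the two new top sites, only the sites
  up to the minimum \<open>r\<close> of the suffix that starts with the maximum; prepending a smaller letter \<open>a\<close>
  keeps exactly the sites above \<open>a\<close>. Hence the number \<open>k\<close> of sites, the number \<open>h\<close> of sites up
  to \<open>r\<close>, and whether \<open>1\<close> is a site determine the whole subtree below \<open>\<pi>\<close>. Since
  \<open>x C\<^sup>2 = C - 1\<close>, the generating functions of the subtrees have explicit closed forms, which
  satisfy the recurrences of the tree and are therefore the right ones. The root \<open>1 \<in> S\<^sub>1(T)\<close> yields
  \<open>F = C + x (C - 1)\<^sup>2 (1 / (1 - 2xC) + x / (1 - 2x)\<^sup>2)\<close>, from which the claim follows by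
  clearing denominators.
\<close>

subsection \<open>Sites\<close>

lemma subseq_Cons_Cons_iff:
  "subseq (x # xs) (y # ys) \<longleftrightarrow> x = y \<and> subseq xs ys \<or> subseq (x # xs) ys"
  by (cases "x = y") (auto dest: subseq_Cons')

lemma subseq_map_iff: "subseq xs (map f ys) \<longleftrightarrow> (\<exists>zs. subseq zs ys \<and> xs = map f zs)"
proof
  assume "subseq xs (map f ys)"
  then show "\<exists>zs. subseq zs ys \<and> xs = map f zs"
  proof (induction ys arbitrary: xs)
    case (Cons y ys)
    show ?case
    proof (cases xs)
      case Nil
      then show ?thesis by auto
    next
      case (Cons x xs')
      with Cons.prems consider "x = f y" "subseq xs' (map f ys)" | "subseq xs (map f ys)"
        by (auto simp: subseq_Cons_Cons_iff simp del: subseq_Cons2_iff)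
      then show ?thesis
      proof cases
        case 1
        with Cons.IH obtain zs where "subseq zs ys" "xs' = map f zs" by blast
        with 1 Cons show ?thesis by (intro exI[of _ "y # zs"]) auto
      next
        case 2
        with Cons.IH show ?thesis by (meson list_emb_Cons)
      qed
    qed
  qed auto
qed (auto intro: subseq_map)

lemma ex_subseq2_map_iff:
  "(\<exists>c d. subseq [c,d] (map f xs) \<and> P c d) \<longleftrightarrow>
    (\<exists>c d. subseq [c,d] xs \<and> P (f c) (f d))"
proof -
  have "subseq [c,d] (map f xs) \<longleftrightarrow>
      (\<exists>c' d'. subseq [c',d'] xs \<and> c = f c' \<and> d = f d')" for c d
    unfolding subseq_map_iff by (auto simp: Cons_eq_map_conv)
  then show ?thesis by metis
qed

lemma ex_subseq3_map_iff:
  "(\<exists>b c d. subseq [b,c,d] (map f xs) \<and> P b c d) \<longleftrightarrow>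
    (\<exists>b c d. subseq [b,c,d] xs \<and> P (f b) (f c) (f d))"
proof -
  have "subseq [b,c,d] (map f xs) \<longleftrightarrow>
      (\<exists>b' c' d'. subseq [b',c',d'] xs \<and> b = f b' \<and> c = f c' \<and> d = f d')" for b c d
    unfolding subseq_map_iff by (auto simp: Cons_eq_map_conv)
  then show ?thesis by metis
qed

lemma ex_subseq4_map_iff:
  "(\<exists>a b c d. subseq [a,b,c,d] (map f xs) \<and> P a b c d) \<longleftrightarrow>
    (\<exists>a b c d. subseq [a,b,c,d] xs \<and> P (f a) (f b) (f c) (f d))"
proof -
  have "subseq [a,b,c,d] (map f xs) \<longleftrightarrow>
      (\<exists>a' b' c' d'. subseq [a',b',c',d'] xs \<and> a = f a' \<and> b = f b' \<and> c = f c' \<and> d = f d')" for a b c d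
    unfolding subseq_map_iff by (auto simp: Cons_eq_map_conv)
  then show ?thesis by metis
qed

lemma ex_subseq3_Cons_iff:
  "(\<exists>b c d. subseq [b,c,d] (x # xs) \<and> P b c d) \<longleftrightarrow>
    (\<exists>c d. subseq [c,d] xs \<and> P x c d) \<or> (\<exists>b c d. subseq [b,c,d] xs \<and> P b c d)"
  unfolding subseq_Cons_Cons_iff by blast

section \<open>Prepending a letter\<close>

definition shift :: "nat \<Rightarrow> nat \<Rightarrow> nat" where
  "shift a v = (if v < a then v else Suc v)"

lemma shift_less_iff [simp]: "shift a u < shift a v \<longleftrightarrow> u < v"
  and shift_le_iff [simp]: "shift a u \<le> shift a v \<longleftrightarrow> u \<le> v"
  and shift_eq_iff [simp]: "shift a u = shift a v \<longleftrightarrow> u = v"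
  by (auto simp: shift_def)

lemma shift_neq [simp]: "shift a v \<noteq> a"
  by (auto simp: shift_def)

lemma shift_cancel: "v \<noteq> a \<Longrightarrow> shift a (if v < a then v else v - 1) = v"
  by (auto simp: shift_def)

lemma image_shift:
  assumes "a \<in> {1..Suc n}"
  shows "shift a ` {1..n} = {1..Suc n} - {a}"
proof
  show "{1..Suc n} - {a} \<subseteq> shift a ` {1..n}"
  proof
    fix v assume "v \<in> {1..Suc n} - {a}"
    then have "v = shift a (if v < a then v else v - 1)" "(if v < a then v else v - 1) \<in> {1..n}"
      using assms by (auto simp: shift_def)
    then show "v \<in> shift a ` {1..n}" by blast
  qed
qed (use assms in \<open>auto simp: shift_def\<close>)

definition insert_first :: "nat \<Rightarrow> nat list \<Rightarrow> nat list" where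
  "insert_first a \<pi> = a # map (shift a) \<pi>"

lemma inj_insert_first: "insert_first a \<pi> = insert_first b \<rho> \<longleftrightarrow> a = b \<and> \<pi> = \<rho>"
proof -
  have "inj (shift b)" by (auto simp: inj_def)
  then show ?thesis by (auto simp: insert_first_def)
qed

lemma length_insert_first [simp]: "length (insert_first a \<pi>) = Suc (length \<pi>)"
  by (simp add: insert_first_def)

lemma insert_first_in_permutations_iff:
  assumes "a \<in> {1..Suc n}"
  shows "insert_first a \<pi> \<in> permutations_of_set {1..Suc n} \<longleftrightarrow> \<pi> \<in> permutations_of_set {1..n}"
proof -
  have inj: "inj (shift a)" by (auto simp: inj_def)
  have "insert a (shift a ` set \<pi>) = {1..Suc n} \<longleftrightarrow> shift a ` set \<pi> = {1..Suc n} - {a}"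
    using assms by auto
  also have "\<dots> \<longleftrightarrow> set \<pi> = {1..n}"
    using image_shift[OF assms] inj by (metis inj_image_eq_iff)
  finally show ?thesis
    using inj by (simp add: insert_first_def permutations_of_set_def distinct_map inj_on_def image_iff
        shift_neq[THEN not_sym])
qed

lemma ex_insert_first:
  assumes "\<sigma> \<in> permutations_of_set {1..Suc n}"
  shows "\<exists>a\<in>{1..Suc n}. \<exists>\<pi>\<in>permutations_of_set {1..n}. \<sigma> = insert_first a \<pi>"
proof -
  obtain a \<tau> where \<sigma>: "\<sigma> = a # \<tau>"
    using assms by (cases \<sigma>) (auto simp: permutations_of_set_def)
  have a: "a \<in> {1..Suc n}" and "a \<notin> set \<tau>"
    using assms by (auto simp: permutations_of_set_def \<sigma>)
  then have "map (shift a) (map (\<lambda>v. if v < a then v else v - 1) \<tau>) = map (\<lambda>v. v) \<tau>"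
    unfolding map_map o_def by (intro map_cong refl shift_cancel) auto
  then have "\<sigma> = insert_first a (map (\<lambda>v. if v < a then v else v - 1) \<tau>)"
    by (simp add: \<sigma> insert_first_def)
  with a assms insert_first_in_permutations_iff[OF a] show ?thesis by metis
qed

section \<open>The three patterns as inequalities between four letters\<close>

lemma order_isomorphic_Cons4:
  "order_isomorphic xs [p,q,r,s] \<longleftrightarrow> (\<exists>a b c d. xs = [a,b,c,d] \<and>
    (a < b \<longleftrightarrow> p < q) \<and> (a < c \<longleftrightarrow> p < r) \<and> (a < d \<longleftrightarrow> p < s) \<and>
    (b < a \<longleftrightarrow> q < p) \<and> (b < c \<longleftrightarrow> q < r) \<and> (b < d \<longleftrightarrow> q < s) \<and>
    (c < a \<longleftrightarrow> r < p) \<and> (c < b \<longleftrightarrow> r < q) \<and> (c < d \<longleftrightarrow> r < s) \<and>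
    (d < a \<longleftrightarrow> s < p) \<and> (d < b \<longleftrightarrow> s < q) \<and> (d < c \<longleftrightarrow> s < r))"
proof (cases "length xs = 4")
  case True
  then obtain a b c d where "xs = [a,b,c,d]"
    by (auto simp: length_Suc_conv numeral_eq_Suc)
  then show ?thesis by (simp add: order_isomorphic_def All_less_Suc) blast
next
  case False
  then have "xs \<noteq> [a,b,c,d]" for a b c d by auto
  with False show ?thesis by (simp add: order_isomorphic_def)
qed

lemma avoids_2341_iff:
  "avoids \<sigma> [2,3,4,1] \<longleftrightarrow> (\<nexists>a b c d. subseq [a,b,c,d] \<sigma> \<and> a < b \<and> b < c \<and> d < a)"
proof -
  have "order_isomorphic xs [2,3,4,1] \<longleftrightarrow>
      (\<exists>a b c d. xs = [a,b,c,d] \<and> a < b \<and> b < c \<and> d < a)" for xs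
    unfolding order_isomorphic_Cons4 by (intro iff_exI, rule conj_cong) auto
  then show ?thesis unfolding avoids_def by metis
qed

lemma avoids_1243_iff:
  "avoids \<sigma> [1,2,4,3] \<longleftrightarrow> (\<nexists>a b c d. subseq [a,b,c,d] \<sigma> \<and> a < b \<and> b < d \<and> d < c)"
proof -
  have "order_isomorphic xs [1,2,4,3] \<longleftrightarrow>
      (\<exists>a b c d. xs = [a,b,c,d] \<and> a < b \<and> b < d \<and> d < c)" for xs
    unfolding order_isomorphic_Cons4 by (intro iff_exI, rule conj_cong) auto
  then show ?thesis unfolding avoids_def by metis
qed

lemma avoids_1234_iff:
  "avoids \<sigma> [1,2,3,4] \<longleftrightarrow> (\<nexists>a b c d. subseq [a,b,c,d] \<sigma> \<and> a < b \<and> b < c \<and> c < d)"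
proof -
  have "order_isomorphic xs [1,2,3,4] \<longleftrightarrow>
      (\<exists>a b c d. xs = [a,b,c,d] \<and> a < b \<and> b < c \<and> c < d)" for xs
    unfolding order_isomorphic_Cons4 by (intro iff_exI, rule conj_cong) auto
  then show ?thesis unfolding avoids_def by metis
qed

abbreviation patterns :: "nat list set" where
  "patterns \<equiv> {[2,3,4,1], [1,2,4,3], [1,2,3,4]}"

text \<open>After an ascent \<open>a < b\<close>, the patterns 1234 and 1243 are the two orders of
  two later letters above \<open>b\<close>; as letters are distinct, they merge into the case
  \<open>b < c\<close>, \<open>b < d\<close>.\<close>

lemma avoids_patterns_iff:
  assumes "distinct \<sigma>"
  shows "(\<forall>\<tau>\<in>patterns. avoids \<sigma> \<tau>) \<longleftrightarrow>
    (\<nexists>a b c d. subseq [a,b,c,d] \<sigma> \<and> a < b \<and> b < c \<and> (b < d \<or> d < a))"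
proof -
  have "a < b \<and> b < c \<and> (b < d \<or> d < a) \<longleftrightarrow>
      (a < b \<and> b < c \<and> d < a) \<or> (a < b \<and> b < d \<and> d < c) \<or> (a < b \<and> b < c \<and> c < d)"
    if "subseq [a,b,c,d] \<sigma>" for a b c d
  proof -
    from that have "distinct [a,b,c,d]" using assms by (meson in_set_subseqs subseqs_distinctD)
    then have "c \<noteq> d" by simp
    then show ?thesis by linarith
  qed
  then have "(\<exists>a b c d. subseq [a,b,c,d] \<sigma> \<and> a < b \<and> b < c \<and> (b < d \<or> d < a)) \<longleftrightarrow>
      (\<exists>a b c d. subseq [a,b,c,d] \<sigma> \<and>
        ((a < b \<and> b < c \<and> d < a) \<or> (a < b \<and> b < d \<and> d < c) \<or> (a < b \<and> b < c \<and> c < d)))"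
    by (intro iff_exI conj_cong refl)
  then show ?thesis
    unfolding ball_simps avoids_2341_iff avoids_1243_iff avoids_1234_iff by blast
qed

text \<open>The inequalities describe patterns that start with the new letter \<open>a\<close>, read
  in \<pi> before the shift: a letter equal to \<open>a\<close> is raised, hence the weak
  \<open>a \<le> b\<close>.\<close>

definition sites :: "nat list \<Rightarrow> nat set" where
  "sites \<pi> = {a \<in> {1..Suc (length \<pi>)}.
     \<nexists>b c d. subseq [b,c,d] \<pi> \<and> a \<le> b \<and> b < c \<and> (b < d \<or> d < a)}"

lemma finite_sites [simp]: "finite (sites \<pi>)"
  by (simp add: sites_def)

lemma less_shift_self_iff: "a < shift a v \<longleftrightarrow> a \<le> v"
  and shift_less_self_iff: "shift a v < a \<longleftrightarrow> v < a"
  by (auto simp: shift_def)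

lemma le_shift_iff: "s \<le> a \<Longrightarrow> s \<le> shift a v \<longleftrightarrow> s \<le> v"
  and shift_less_iff_low: "s \<le> a \<Longrightarrow> shift a v < s \<longleftrightarrow> v < s"
  and Suc_le_shift_iff: "a \<le> s \<Longrightarrow> Suc s \<le> shift a v \<longleftrightarrow> s \<le> v"
  and shift_less_Suc_iff: "a \<le> s \<Longrightarrow> shift a v < Suc s \<longleftrightarrow> v < s"
  by (auto simp: shift_def)

lemma insert_first_avoids_iff:
  assumes "\<pi> \<in> permutations_of_set {1..n}" "a \<in> {1..Suc n}"
  shows "(\<forall>\<tau>\<in>patterns. avoids (insert_first a \<pi>) \<tau>) \<longleftrightarrow>
    (\<forall>\<tau>\<in>patterns. avoids \<pi> \<tau>) \<and> a \<in> sites \<pi>"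
proof -
  let ?P = "\<lambda>a b c d :: nat. a < b \<and> b < c \<and> (b < d \<or> d < a)"
  have len: "length \<pi> = n"
    using assms(1) by (auto simp: length_finite_permutations_of_set)
  have dist: "distinct \<pi>" "distinct (insert_first a \<pi>)"
    using assms insert_first_in_permutations_iff[OF assms(2)] permutations_of_setD(2) by blast+
  have "(\<exists>w b c d. subseq [w,b,c,d] (insert_first a \<pi>) \<and> ?P w b c d) \<longleftrightarrow>
    (\<exists>b c d. subseq [b,c,d] (map (shift a) \<pi>) \<and> ?P a b c d) \<or>
    (\<exists>w b c d. subseq [w,b,c,d] (map (shift a) \<pi>) \<and> ?P w b c d)"
    unfolding insert_first_def subseq_Cons_Cons_iff by blast
  also have "(\<exists>b c d. subseq [b,c,d] (map (shift a) \<pi>) \<and> ?P a b c d) \<longleftrightarrow>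
    (\<exists>b c d. subseq [b,c,d] \<pi> \<and> a \<le> b \<and> b < c \<and> (b < d \<or> d < a))"
    unfolding ex_subseq3_map_iff[where P = "?P a"] by (simp add: less_shift_self_iff shift_less_self_iff)
  also have "(\<exists>w b c d. subseq [w,b,c,d] (map (shift a) \<pi>) \<and> ?P w b c d) \<longleftrightarrow>
    (\<exists>w b c d. subseq [w,b,c,d] \<pi> \<and> ?P w b c d)"
    unfolding ex_subseq4_map_iff[where P = ?P] by simp
  finally show ?thesis
    using assms(2)
    unfolding avoids_patterns_iff[OF dist(1)] avoids_patterns_iff[OF dist(2)] sites_def len by blast
qed

text \<open>Deleting the first letter inverts prepending at a site. The general summand
  \<open>f\<close> is needed because later sums weight permutations by their states.\<close>

lemma sum_avoiders_Suc:
  fixes f :: "nat list \<Rightarrow> 'a::comm_monoid_add"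
  shows "(\<Sum>\<sigma>\<in>avoiders patterns (Suc n). f \<sigma>) =
    (\<Sum>\<pi>\<in>avoiders patterns n. \<Sum>a\<in>sites \<pi>. f (insert_first a \<pi>))"
proof -
  let ?A = "avoiders patterns"
  have fin: "finite (?A n)" by (simp add: avoiders_def)
  have sub: "a \<in> {1..Suc n}" if "\<pi> \<in> ?A n" "a \<in> sites \<pi>" for \<pi> a
    using that by (auto simp: avoiders_def sites_def length_finite_permutations_of_set)
  have "bij_betw (\<lambda>(\<pi>, a). insert_first a \<pi>) (SIGMA \<pi>:?A n. sites \<pi>) (?A (Suc n))"
  proof (rule bij_betwI')
    fix p assume "p \<in> (SIGMA \<pi>:?A n. sites \<pi>)"
    then obtain \<pi> a where p: "p = (\<pi>, a)" "\<pi> \<in> ?A n" "a \<in> sites \<pi>" by blast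
    with sub have a: "a \<in> {1..Suc n}" by blast
    with p have "insert_first a \<pi> \<in> ?A (Suc n)"
      using insert_first_avoids_iff[of \<pi> n a] insert_first_in_permutations_iff[of a n \<pi>]
      unfolding avoiders_def by blast
    with p show "(case p of (\<pi>, a) \<Rightarrow> insert_first a \<pi>) \<in> ?A (Suc n)" by simp
  next
    fix \<sigma> assume \<sigma>: "\<sigma> \<in> ?A (Suc n)"
    then obtain a \<pi> where a: "a \<in> {1..Suc n}" "\<pi> \<in> permutations_of_set {1..n}"
      "\<sigma> = insert_first a \<pi>" using ex_insert_first unfolding avoiders_def by blast
    with \<sigma> have "\<pi> \<in> ?A n" "a \<in> sites \<pi>"
      using insert_first_avoids_iff[of \<pi> n a] unfolding avoiders_def by blast+
    with a show "\<exists>p\<in>SIGMA \<pi>:?A n. sites \<pi>. \<sigma> = (case p of (\<pi>, a) \<Rightarrow> insert_first a \<pi>)"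
      by (intro bexI[of _ "(\<pi>, a)"]) auto
  qed (auto simp: inj_insert_first)
  from sum.reindex_bij_betw[OF this, of f] fin show ?thesis
    by (simp add: sum.Sigma case_prod_unfold)
qed

text \<open>
  A letter \<open>c\<close> of \<open>\<pi>\<close> that is at least \<open>a\<close> becomes an ascent \<open>a c\<close> after the insertion, so
  that the sites up to \<open>a\<close> survive only if no letter \<open>d\<close> after \<open>c\<close> closes a forbidden pattern.
\<close>

lemma sites_insert_first:
  assumes "a \<in> {1..Suc (length \<pi>)}"
  shows "sites (insert_first a \<pi>) =
    {s \<in> sites \<pi>. s \<le> a \<and> (\<nexists>c d. subseq [c,d] \<pi> \<and> a \<le> c \<and> (a \<le> d \<or> d < s))} \<union>
    Suc ` {s \<in> sites \<pi>. a \<le> s}" (is "?L = ?low \<union> Suc ` ?high")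
proof -
  let ?P = "\<lambda>s b c d :: nat. s \<le> b \<and> b < c \<and> (b < d \<or> d < s)"
  have all: "s \<in> ?L \<longleftrightarrow> s \<in> {1..Suc (Suc (length \<pi>))} \<and>
      \<not> ((\<exists>c d. subseq [c,d] \<pi> \<and> ?P s a (shift a c) (shift a d)) \<or>
         (\<exists>b c d. subseq [b,c,d] \<pi> \<and> ?P s (shift a b) (shift a c) (shift a d)))" for s
  proof -
    have "s \<in> ?L \<longleftrightarrow> s \<in> {1..Suc (Suc (length \<pi>))} \<and>
        \<not> (\<exists>b c d. subseq [b,c,d] (a # map (shift a) \<pi>) \<and> ?P s b c d)"
      by (simp add: sites_def insert_first_def)
    then show ?thesis
      unfolding ex_subseq3_Cons_iff[where P = "?P s"] ex_subseq3_map_iff[where P = "?P s"]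
        ex_subseq2_map_iff[where P = "?P s a"] .
  qed
  have low: "s \<in> ?L \<longleftrightarrow> s \<in> ?low" if "s \<le> a" for s
  proof -
    have "(\<exists>c d. subseq [c,d] \<pi> \<and> ?P s a (shift a c) (shift a d)) \<longleftrightarrow>
        (\<exists>c d. subseq [c,d] \<pi> \<and> a \<le> c \<and> (a \<le> d \<or> d < s))"
      using that by (simp add: shift_less_iff_low[OF that] less_shift_self_iff)
    moreover have "(\<exists>b c d. subseq [b,c,d] \<pi> \<and> ?P s (shift a b) (shift a c) (shift a d)) \<longleftrightarrow>
        (\<exists>b c d. subseq [b,c,d] \<pi> \<and> ?P s b c d)"
      by (simp add: le_shift_iff[OF that] shift_less_iff_low[OF that])
    moreover have "s \<in> {1..Suc (Suc (length \<pi>))} \<longleftrightarrow> s \<in> {1..Suc (length \<pi>)}"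
      using that assms by auto
    ultimately show ?thesis
      unfolding all unfolding mem_Collect_eq sites_def using that by argo
  qed
  \<comment> \<open>A letter prepended above \<open>a\<close> exceeds it, so \<open>a\<close> cannot
    act as \<open>b\<close> and only triples from \<pi> matter. The site \<open>a\<close> itself
    reappears here as \<open>Suc a\<close>.\<close>
  have high: "Suc s \<in> ?L \<longleftrightarrow> s \<in> ?high" if "a \<le> s" for s
    using that assms unfolding all unfolding sites_def
    by (simp add: Suc_le_shift_iff[OF that] shift_less_Suc_iff[OF that])
  show ?thesis
  proof (rule set_eqI)
    fix s
    show "s \<in> ?L \<longleftrightarrow> s \<in> ?low \<union> Suc ` ?high"
    proof (cases "s \<le> a")
      case True
      then show ?thesis using low[OF True] by auto
    next
      case False
      then obtain t where "s = Suc t" "a \<le> t" by (cases s) auto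
      then show ?thesis using high[of t] by auto
    qed
  qed
qed

subsection \<open>The generating tree\<close>

text \<open>
  The smallest letter weakly to the right of the largest letter, which is \<open>length \<pi>\<close> for a
  permutation of \<open>{1..n}\<close>. It decides which sites remain when the new first letter becomes the
  second largest one.
\<close>

definition suffix_min :: "nat list \<Rightarrow> nat" where
  "suffix_min \<pi> = Min (insert (length \<pi>) {d. subseq [length \<pi>, d] \<pi>})"

text \<open>
  The flag \<open>1 \<in> sites \<pi>\<close> records that no letter of \<open>\<pi>\<close> has two larger letters to its right.
\<close>

definition state :: "nat list \<Rightarrow> nat \<times> nat \<times> bool" where
  "state \<pi> = (card (sites \<pi>), card {s \<in> sites \<pi>. s \<le> suffix_min \<pi>}, 1 \<in> sites \<pi>)"

text \<open>Counts the nodes \<open>m\<close> levels below a node. The terms belong to prepending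
  the maximum, the second largest letter, and a smaller site with \<open>j\<close> sites weakly
  above it; \<open>j\<close> starts at 3 because the two top values are sites. The truncated
  \<open>j - (k - h)\<close> is 0 if that smaller site exceeds \<open>suffix_min\<close>.\<close>

fun descendants :: "nat \<Rightarrow> nat \<times> nat \<times> bool \<Rightarrow> nat" where
  "descendants 0 s = 1"
| "descendants (Suc m) (k, h, f) =
     descendants m (Suc k, of_bool f, f) +
     descendants m (h + 2, if Suc h = k then Suc h else h, f) +
     (\<Sum>j=3..k. descendants m (j, j - (k - h), False))"

lemma subseq_pair_cases:
  "x \<in> set xs \<Longrightarrow> y \<in> set xs \<Longrightarrow> x \<noteq> y \<Longrightarrow> subseq [x,y] xs \<or> subseq [y,x] xs"
  by (induction xs) (auto simp: subseq_singleton_left)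

lemma subseq_pair_neq: "subseq [x,y] xs \<Longrightarrow> distinct xs \<Longrightarrow> x \<noteq> y"
  using subseqs_distinctD[of "[x,y]" xs] by auto

text \<open>Ranks counted from the top take each value once: a new minimum gets the next rank and
  leaves the others unchanged.\<close>

lemma sum_card_up:
  fixes A :: "nat set" and g :: "nat \<Rightarrow> nat"
  assumes "finite A"
  shows "(\<Sum>a\<in>A. g (card {s \<in> A. a \<le> s})) = (\<Sum>j=1..card A. g j)"
  using assms
proof (induction A rule: finite_linorder_min_induct)
  case (insert b A)
  have "b \<notin> A" using insert.hyps by auto
  have "{s \<in> insert b A. b \<le> s} = insert b A"
    using insert.hyps by auto
  moreover have "{s \<in> insert b A. a \<le> s} = {s \<in> A. a \<le> s}" if "a \<in> A" for a
    using insert.hyps that by auto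
  ultimately have "(\<Sum>a\<in>insert b A. g (card {s \<in> insert b A. a \<le> s})) =
      g (Suc (card A)) + (\<Sum>a\<in>A. g (card {s \<in> A. a \<le> s}))"
    using insert.hyps \<open>b \<notin> A\<close> by simp
  with insert \<open>b \<notin> A\<close> show ?case by simp
qed simp

text \<open>Remove the elements above \<open>r\<close> from those \<open>\<ge> a\<close>; for
  \<open>a > r\<close> nothing remains and truncation gives 0.\<close>

lemma card_between:
  fixes A :: "nat set"
  assumes "finite A"
  shows "card {s \<in> A. a \<le> s \<and> s \<le> r} = card {s \<in> A. a \<le> s} - (card A - card {s \<in> A. s \<le> r})"
proof -
  have "A = {s \<in> A. s \<le> r} \<union> {s \<in> A. r < s}" by auto
  then have "card A = card {s \<in> A. s \<le> r} + card {s \<in> A. r < s}"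
    using assms
    by (metis (no_types, lifting) card_Un_disjoint disjoint_iff finite_Un linorder_not_less
        mem_Collect_eq)
  then have *: "card A - card {s \<in> A. s \<le> r} = card {s \<in> A. r < s}" by simp
  show ?thesis
  proof (cases "a \<le> r")
    case True
    then have "{s \<in> A. a \<le> s} = {s \<in> A. a \<le> s \<and> s \<le> r} \<union> {s \<in> A. r < s}" by auto
    moreover have "{s \<in> A. a \<le> s \<and> s \<le> r} \<inter> {s \<in> A. r < s} = {}" by auto
    ultimately have "card {s \<in> A. a \<le> s} = card {s \<in> A. a \<le> s \<and> s \<le> r} + card {s \<in> A. r < s}"
      using assms by (simp add: card_Un_disjoint)
    then show ?thesis unfolding * by simp
  next
    case False
    then have "{s \<in> A. a \<le> s} \<subseteq> {s \<in> A. r < s}" by auto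
    then have "card {s \<in> A. a \<le> s} \<le> card {s \<in> A. r < s}"
      using assms by (intro card_mono) auto
    moreover have "{s \<in> A. a \<le> s \<and> s \<le> r} = {}" using False by auto
    ultimately show ?thesis unfolding * by simp
  qed
qed

section \<open>Children of a nonempty permutation\<close>

context
  fixes n :: nat and \<pi> :: "nat list"
  assumes perm: "\<pi> \<in> permutations_of_set {1..n}" and n_pos: "1 \<le> n"
begin

lemma set_perm: "set \<pi> = {1..n}" and distinct_perm: "distinct \<pi>" and length_perm: "length \<pi> = n"
  using perm by (auto simp: permutations_of_set_def distinct_card[symmetric])

lemma subseq_le: "subseq xs \<pi> \<Longrightarrow> v \<in> set xs \<Longrightarrow> 1 \<le> v \<and> v \<le> n"
  using list_emb_set[of "(=)" xs \<pi> v] set_perm by auto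

lemma sites_bounds: "s \<in> sites \<pi> \<Longrightarrow> 1 \<le> s \<and> s \<le> Suc n"
  by (simp add: sites_def length_perm)

text \<open>A violation needs letters \<open>b < c\<close> with \<open>n \<le> b\<close>, but
  \<open>n\<close> is the largest letter.\<close>

lemma max_sites: "n \<in> sites \<pi>" "Suc n \<in> sites \<pi>"
  using n_pos subseq_le by (fastforce simp: sites_def length_perm)+

lemma after_max_finite: "finite {d. subseq [n,d] \<pi>}"
  by (rule finite_subset[of _ "{1..n}"]) (use subseq_le in fastforce)+

lemma suffix_min_ge: "s \<le> suffix_min \<pi> \<longleftrightarrow> s \<le> n \<and> (\<forall>d. subseq [n,d] \<pi> \<longrightarrow> s \<le> d)"
  using after_max_finite by (auto simp: suffix_min_def length_perm)

lemma suffix_min_bounds: "1 \<le> suffix_min \<pi>" "suffix_min \<pi> \<le> n"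
  using suffix_min_ge[of 1] suffix_min_ge[of "suffix_min \<pi>"] n_pos subseq_le by fastforce+

text \<open>No letter of \<pi> reaches \<open>Suc n\<close>, so no site is lost, and the top site
  \<open>Suc n\<close> splits in two.\<close>

lemma sites_insert_max: "sites (insert_first (Suc n) \<pi>) = insert (Suc (Suc n)) (sites \<pi>)"
proof -
  have "c \<le> n" if "subseq [c,d] \<pi>" for c d
    using subseq_le[OF that] by simp
  then have "sites (insert_first (Suc n) \<pi>) =
      {s \<in> sites \<pi>. s \<le> Suc n} \<union> Suc ` {s \<in> sites \<pi>. Suc n \<le> s}"
    by (subst sites_insert_first) (fastforce simp: length_perm)+
  also have "{s \<in> sites \<pi>. s \<le> Suc n} = sites \<pi>" using sites_bounds by blast
  also have "{s \<in> sites \<pi>. Suc n \<le> s} = {Suc n}" using sites_bounds max_sites by force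
  finally show ?thesis by simp
qed

text \<open>Only \<open>c = n\<close> is large enough, so a site \<open>s \<le> n\<close> survives
  exactly if no letter below \<open>s\<close> follows \<open>n\<close>.\<close>

lemma sites_insert_submax:
  "sites (insert_first n \<pi>) = {s \<in> sites \<pi>. s \<le> suffix_min \<pi>} \<union> {Suc n, Suc (Suc n)}"
proof -
  have "s \<le> n \<and> (\<nexists>c d. subseq [c,d] \<pi> \<and> n \<le> c \<and> (n \<le> d \<or> d < s)) \<longleftrightarrow> s \<le> suffix_min \<pi>" for s
  proof -
    have "subseq [c,d] \<pi> \<and> n \<le> c \<and> (n \<le> d \<or> d < s) \<longleftrightarrow> c = n \<and> subseq [n,d] \<pi> \<and> d < s" for c d
    proof -
      have "c \<le> n \<and> d \<le> n \<and> c \<noteq> d" if "subseq [c,d] \<pi>"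
        using subseq_le[OF that] subseq_pair_neq[OF that distinct_perm] by simp
      then show ?thesis by (metis le_antisym order_refl)
    qed
    then show ?thesis unfolding suffix_min_ge by (auto simp: not_less)
  qed
  moreover have "{s \<in> sites \<pi>. n \<le> s} = {n, Suc n}" using sites_bounds max_sites by force
  ultimately show ?thesis
    using sites_insert_first[of n \<pi>] n_pos by (simp add: length_perm)
qed

text \<open>The letters \<open>n - 1\<close> and \<open>n\<close>, in whichever order, are both at
  least \<open>a\<close> and serve as \<open>c\<close> and \<open>d\<close>, which rules out every
  site \<open>\<le> a\<close> of the new word.\<close>

lemma sites_insert_low:
  assumes "a \<in> sites \<pi>" "a < n"
  shows "sites (insert_first a \<pi>) = Suc ` {s \<in> sites \<pi>. a \<le> s}"
proof -
  have "1 \<le> a" using sites_bounds assms by blast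
  with assms have "n - 1 \<in> set \<pi>" "n \<in> set \<pi>" "n - 1 \<noteq> n" by (auto simp: set_perm)
  then have "subseq [n - 1, n] \<pi> \<or> subseq [n, n - 1] \<pi>" by (rule subseq_pair_cases)
  moreover have "a \<le> n - 1" "a \<le> n" using assms by auto
  ultimately have ex: "\<exists>c d. subseq [c,d] \<pi> \<and> a \<le> c \<and> (a \<le> d \<or> d < s)" for s by blast
  then show ?thesis
    using assms \<open>1 \<le> a\<close> by (simp add: sites_insert_first length_perm ex del: not_ex)
qed

lemma suffix_min_insert_max: "suffix_min (insert_first (Suc n) \<pi>) = 1"
proof -
  have "map (shift (Suc n)) \<pi> = map id \<pi>"
    by (intro map_cong) (auto simp: set_perm shift_def)
  then have "insert_first (Suc n) \<pi> = Suc n # \<pi>" by (simp add: insert_first_def)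
  moreover have "{d. subseq [Suc n, d] (Suc n # \<pi>)} = {1..n}"
    by (auto simp: subseq_singleton_left set_perm)
  moreover have "Min (insert (Suc n) {1..n}) = 1"
    using n_pos by (intro Min_eqI) auto
  ultimately show ?thesis by (simp add: suffix_min_def length_perm)
qed

text \<open>The maximum stays the same entry of the word, and the increasing map
  \<open>shift a\<close> commutes with the minimum.\<close>

lemma suffix_min_insert_low:
  assumes "a \<le> n"
  shows "suffix_min (insert_first a \<pi>) = shift a (suffix_min \<pi>)"
proof -
  have sn: "shift a n = Suc n" using assms by (simp add: shift_def)
  have "{d. subseq [Suc n, d] (insert_first a \<pi>)} = shift a ` {d. subseq [n,d] \<pi>}"
  proof -
    have "subseq [Suc n, d] (insert_first a \<pi>) \<longleftrightarrow> subseq [Suc n, d] (map (shift a) \<pi>)" for d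
      using assms by (simp add: insert_first_def)
    also have "\<dots> d \<longleftrightarrow> (\<exists>d'. subseq [n,d'] \<pi> \<and> d = shift a d')" for d
      unfolding subseq_map_iff sn[symmetric] by (auto simp: Cons_eq_map_conv)
    finally show ?thesis by blast
  qed
  then have "suffix_min (insert_first a \<pi>) = Min (shift a ` insert n {d. subseq [n,d] \<pi>})"
    by (simp add: suffix_min_def length_perm sn)
  also have "\<dots> = shift a (suffix_min \<pi>)"
    unfolding suffix_min_def length_perm using after_max_finite
    by (intro mono_Min_commute[symmetric]) (auto simp: mono_def)
  finally show ?thesis .
qed

lemma state_insert_max:
  "state (insert_first (Suc n) \<pi>) = (Suc (card (sites \<pi>)), of_bool (1 \<in> sites \<pi>), 1 \<in> sites \<pi>)"
proof -
  have "Suc (Suc n) \<notin> sites \<pi>" using sites_bounds by force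
  moreover have "{s \<in> insert (Suc (Suc n)) (sites \<pi>). s \<le> 1} = (if 1 \<in> sites \<pi> then {1} else {})"
    using sites_bounds by force
  ultimately show ?thesis
    by (simp add: state_def sites_insert_max suffix_min_insert_max)
qed

lemma state_insert_submax:
  assumes "k = card (sites \<pi>)" "h = card {s \<in> sites \<pi>. s \<le> suffix_min \<pi>}"
  shows "state (insert_first n \<pi>) = (h + 2, if Suc h = k then Suc h else h, 1 \<in> sites \<pi>)"
proof -
  let ?H = "{s \<in> sites \<pi>. s \<le> suffix_min \<pi>}"
  have notin: "Suc n \<notin> ?H" "Suc (Suc n) \<notin> ?H" using suffix_min_bounds by auto
  then have 1: "card (sites (insert_first n \<pi>)) = h + 2"
    by (simp add: sites_insert_submax assms)
  have 2: "1 \<in> sites (insert_first n \<pi>) \<longleftrightarrow> 1 \<in> sites \<pi>"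
    using suffix_min_bounds n_pos by (simp add: sites_insert_submax)
  have 3: "card {s \<in> sites (insert_first n \<pi>). s \<le> suffix_min (insert_first n \<pi>)} =
      (if Suc h = k then Suc h else h)"
  \<comment> \<open>As \<open>n\<close> and \<open>Suc n\<close> are sites, \<open>Suc h = k\<close>
    exactly if \<open>suffix_min \<pi> = n\<close>. Then the minimum moves to \<open>Suc n\<close>
    and counts that new site too; otherwise it stays put below \<open>n\<close>.\<close>
  proof (cases "suffix_min \<pi> = n")
    case True
    then have "sites \<pi> = insert (Suc n) ?H" using sites_bounds max_sites by force
    then have "k = card (insert (Suc n) ?H)" unfolding assms by (rule arg_cong)
    then have "Suc h = k" using notin assms(2) by simp
    moreover have "{s \<in> sites (insert_first n \<pi>). s \<le> Suc n} = insert (Suc n) ?H"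
      using True by (auto simp: sites_insert_submax)
    ultimately show ?thesis using True notin assms by (simp add: suffix_min_insert_low shift_def)
  next
    case False
    then have less: "suffix_min \<pi> < n" using suffix_min_bounds by simp
    have "card (insert n (insert (Suc n) ?H)) \<le> k"
      unfolding assms using max_sites by (intro card_mono) auto
    then have "h + 2 \<le> k" using notin less assms by simp
    moreover have "{s \<in> sites (insert_first n \<pi>). s \<le> suffix_min \<pi>} = ?H"
      using less by (auto simp: sites_insert_submax)
    ultimately show ?thesis using less assms by (simp add: suffix_min_insert_low shift_def)
  qed
  show ?thesis using 1 2 3 by (simp add: state_def)
qed

lemma state_insert_low:
  assumes "k = card (sites \<pi>)" "h = card {s \<in> sites \<pi>. s \<le> suffix_min \<pi>}"
    and "a \<in> sites \<pi>" "a < n" "j = card {s \<in> sites \<pi>. a \<le> s}"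
  shows "state (insert_first a \<pi>) = (j, j - (k - h), False)"
proof -
  have inj: "inj_on Suc A" for A by simp
  have "1 \<le> a" using assms sites_bounds by blast
  have "{s \<in> Suc ` {s \<in> sites \<pi>. a \<le> s}. s \<le> shift a (suffix_min \<pi>)} =
      Suc ` {s \<in> sites \<pi>. a \<le> s \<and> s \<le> suffix_min \<pi>}"
    using Suc_le_shift_iff by auto
  moreover have "1 \<notin> Suc ` {s \<in> sites \<pi>. a \<le> s}" using \<open>1 \<le> a\<close> by auto
  ultimately show ?thesis
    using suffix_min_insert_low[of a] assms(3,4) unfolding state_def
    by (simp add: sites_insert_low card_image card_between assms(1,2,5))
qed

lemma sum_descendants_sites:
  "(\<Sum>a\<in>sites \<pi>. descendants m (state (insert_first a \<pi>))) = descendants (Suc m) (state \<pi>)"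
proof -
  define L where "L = {a \<in> sites \<pi>. a < n}"
  define k where "k = card (sites \<pi>)"
  define h where "h = card {s \<in> sites \<pi>. s \<le> suffix_min \<pi>}"
  have sites: "sites \<pi> = insert (Suc n) (insert n L)"
    using sites_bounds max_sites unfolding L_def by force
  have L: "finite L" "n \<notin> L" "Suc n \<notin> L" by (auto simp: L_def)
  have k: "k = card L + 2" unfolding k_def sites using L by simp
  let ?g = "\<lambda>j. descendants m (j, j - (k - h), False)"
  have "(\<Sum>a\<in>L. descendants m (state (insert_first a \<pi>))) =
      (\<Sum>a\<in>L. ?g (card {s \<in> L. a \<le> s} + 2))"
  proof (rule sum.cong)
    fix a assume "a \<in> L"
    then have a: "a \<in> sites \<pi>" "a < n" by (auto simp: L_def)
    \<comment> \<open>The sites \<open>n\<close> and \<open>Suc n\<close> shift ranks in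
      \<open>L\<close> by 2.\<close>
    then have "{s \<in> sites \<pi>. a \<le> s} = insert (Suc n) (insert n {s \<in> L. a \<le> s})"
      unfolding sites by auto
    then have "card {s \<in> sites \<pi>. a \<le> s} = card {s \<in> L. a \<le> s} + 2"
      using L by simp
    with state_insert_low[OF k_def h_def a refl]
    show "descendants m (state (insert_first a \<pi>)) = ?g (card {s \<in> L. a \<le> s} + 2)"
      by simp
  qed simp
  also have "\<dots> = (\<Sum>j=1..card L. ?g (j + 2))"
    by (rule sum_card_up[OF L(1)])
  also have "\<dots> = (\<Sum>j=3..k. ?g j)"
    using sum.shift_bounds_cl_nat_ivl[of ?g 1 2 "card L"] by (simp add: k numeral_3_eq_3)
  finally have "(\<Sum>a\<in>L. descendants m (state (insert_first a \<pi>))) = (\<Sum>j=3..k. ?g j)" .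
  then have "(\<Sum>a\<in>sites \<pi>. descendants m (state (insert_first a \<pi>))) =
      descendants m (state (insert_first (Suc n) \<pi>)) +
      descendants m (state (insert_first n \<pi>)) + (\<Sum>j=3..k. ?g j)"
    unfolding sites using L by simp
  also have "\<dots> = descendants (Suc m) (k, h, 1 \<in> sites \<pi>)"
    unfolding state_insert_max state_insert_submax[OF k_def h_def] by (simp add: k_def)
  finally show ?thesis by (simp add: state_def k_def h_def)
qed

end

section \<open>The root and the counting sequence\<close>

lemma avoiders_1: "avoiders patterns 1 = {[1]}"
proof -
  have "permutations_of_set {1..1::nat} = {[1]}" by simp
  moreover have "avoids [1] \<tau>" if "length \<tau> = 4" for \<tau>
    using that by (auto simp: avoids_def order_isomorphic_def dest: list_emb_length)
  ultimately show ?thesis by (auto simp: avoiders_def)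
qed

lemma state_singleton: "state [1] = (2, 1, True)"
proof -
  have "\<not> subseq [b,c,d] [1::nat]" "\<not> subseq [b,c] [1::nat]" for b c d
    by (auto dest: list_emb_length)
  then have "sites [1] = {1, 2}" "suffix_min [1] = 1"
    by (auto simp: sites_def suffix_min_def)
  moreover have "{s \<in> {1, 2}. s \<le> 1} = {1::nat}" by auto
  ultimately show ?thesis by (simp add: state_def)
qed

text \<open>Induction on \<open>n\<close> for all \<open>m\<close>: a step down the tree trades one
  level for one unit of depth. The root is \<open>[1]\<close> because the rules for children require
  \<open>1 \<le> n\<close>.\<close>

lemma sum_descendants_avoiders:
  "(\<Sum>\<pi>\<in>avoiders patterns (Suc n). descendants m (state \<pi>)) = descendants (n + m) (2, 1, True)"
proof (induction n arbitrary: m)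
  case 0
  show ?case using avoiders_1 state_singleton by simp
next
  case (Suc n)
  have "(\<Sum>\<pi>\<in>avoiders patterns (Suc (Suc n)). descendants m (state \<pi>)) =
      (\<Sum>\<pi>\<in>avoiders patterns (Suc n). descendants (Suc m) (state \<pi>))"
    unfolding sum_avoiders_Suc[of _ "Suc n"]
    by (intro sum.cong refl sum_descendants_sites[where n = "Suc n"]) (auto simp: avoiders_def)
  with Suc show ?case by simp
qed

lemma card_avoiders_Suc: "card (avoiders patterns (Suc n)) = descendants n (2, 1, True)"
  using sum_descendants_avoiders[of 0 n] by simp

lemma card_avoiders_0: "card (avoiders patterns 0) = 1"
proof -
  have "avoids [] \<tau>" if "\<tau> \<noteq> []" for \<tau>
    using that by (auto simp: avoids_def order_isomorphic_def)
  then have "avoiders patterns 0 = {[]}" by (auto simp: avoiders_def)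
  then show ?thesis by simp
qed

subsection \<open>Generating functions\<close>

text \<open>Completing the square: with \<open>2xC = 1 - R\<close> and \<open>R^2 = 1 - 4x\<close>,
  the series \<open>4x(xC^2 - C + 1) = (2xC - 1)^2 - (1 - 4x)\<close> vanishes, and
  \<open>4x\<close> cancels.\<close>

lemma catalan_gf_quadratic: "fps_X * catalan_gf ^ 2 = catalan_gf - 1"
proof -
  define R :: "real fps" where "R = fps_radical root 2 (1 - 4 * fps_X)"
  have sq: "R ^ 2 = 1 - 4 * fps_X"
    using power_radical[of "1 - 4 * fps_X :: real fps" root 1]
    by (simp add: R_def numeral_2_eq_2)
  \<comment> \<open>This makes \<open>2x\<close> divide \<open>1 - R\<close>, so the quotient
    \<open>catalan_gf\<close> multiplies back to \<open>1 - R\<close>.\<close>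
  have "fps_nth (1 - R) 0 = 0"
    by (simp add: R_def)
  then have "1 - R = fps_X * fps_shift 1 (1 - R)"
    by (intro fps_ext) (simp add: fps_X_mult_nth del: fps_sub_nth)
  also have "\<dots> = 2 * fps_X * (fps_const (1/2) * fps_shift 1 (1 - R))"
  proof -
    have "2 * fps_const (1/2) = (1 :: real fps)" by (simp add: numeral_fps_const)
    then show ?thesis by algebra
  qed
  finally have "2 * fps_X dvd 1 - R" by (rule dvdI)
  then have C: "2 * fps_X * catalan_gf = 1 - R"
    by (simp add: catalan_gf_def R_def)
  have "4 * fps_X * (fps_X * catalan_gf ^ 2 - catalan_gf + 1) =
      (2 * fps_X * catalan_gf - 1) ^ 2 - (1 - 4 * fps_X)"
    by algebra
  also have "\<dots> = 0" by (simp add: C sq)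
  finally have "fps_X * catalan_gf ^ 2 - catalan_gf + 1 = 0" by simp
  then show ?thesis by algebra
qed

section \<open>Closed forms for the generating functions of the subtrees\<close>

context
  fixes C i s :: "real fps"
  assumes quadratic: "fps_X * C ^ 2 = C - 1"
    and inverse_two: "i * (1 - 2 * fps_X) = 1"
    and inverse_root: "s * (1 - 2 * fps_X * C) = 1"
begin

definition diagonal_gf :: "nat \<Rightarrow> real fps" where
  "diagonal_gf k = (1 + fps_X * (C - 1) * s * of_nat (k - 1)) * C ^ k"

text \<open>
  The diagonal states, those with \<open>h = k - 1\<close>, solve a recurrence whose inhomogeneous term \<open>C\<^sup>k\<close>
  is itself a solution of the homogeneous recurrence; this resonance produces the factor linear
  in \<open>k\<close> and the inverse \<open>s\<close> of \<open>1 - 2xC\<close>. Off the diagonal, the solutions differ only by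
  constants from the \<open>C\<^sup>k\<close> of the Catalan tree with rule \<open>(k) \<longrightarrow> (2)(3)\<dots>(k + 1)\<close>.
\<close>

definition state_gf :: "nat \<Rightarrow> nat \<Rightarrow> bool \<Rightarrow> real fps" where
  "state_gf k h f =
    (if f then
       if Suc h = k then diagonal_gf k + fps_X * (C - 1) ^ 2 * i ^ 2
       else C ^ k + (1 - fps_X) * (C - 1) ^ 2 * i ^ 2
     else if h = 0 then C ^ k
     else if Suc h = k then diagonal_gf k
     else C ^ k + (C - 1) ^ 2 * i)"

text \<open>By \<open>quadratic\<close>, \<open>x C^j = C^(j-1) - C^(j-2)\<close>, which telescopes
  to \<open>C^(k-1) - C\<close>; and \<open>1 - xC\<close> is the inverse of
  \<open>C\<close>.\<close>

lemma sum_powers: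
  assumes "2 \<le> k"
  shows "fps_X * (\<Sum>j=3..k. C ^ j) = (1 - fps_X * C) * C ^ k - C"
  using assms
proof (induction k rule: dec_induct)
  case base
  show ?case using quadratic by simp algebra
next
  case (step k)
  then have "{3..Suc k} = insert (Suc k) {3..k}" by auto
  then have "fps_X * (\<Sum>j=3..Suc k. C ^ j) = fps_X * C ^ Suc k + fps_X * (\<Sum>j=3..k. C ^ j)"
    by (simp add: algebra_simps)
  also have "\<dots> = (1 - fps_X * C) * C ^ Suc k - C"
  proof -
    define y where "y = C ^ k"
    show ?thesis
      unfolding step.IH power_Suc y_def[symmetric] using quadratic by algebra
  qed
  finally show ?case .
qed

text \<open>The recurrence of the diagonal states, solved for its sum. Comparing consecutive
  \<open>k\<close> leaves a three-term relation, which the slope \<open>x (C - 1) s\<close>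
  satisfies since \<open>C (1 - 2xC) = 2 - C\<close>.\<close>

lemma sum_diagonal_gf:
  assumes "2 \<le> k"
  shows "fps_X * (\<Sum>j=3..k. diagonal_gf j) =
    diagonal_gf k - 1 - fps_X * C ^ Suc k - fps_X * diagonal_gf (Suc k)"
  using assms
proof (induction k rule: dec_induct)
  case base
  show ?case using quadratic inverse_root by (simp add: diagonal_gf_def numeral_3_eq_3) algebra
next
  case (step k)
  then have "{3..Suc k} = insert (Suc k) {3..k}" by auto
  then have "fps_X * (\<Sum>j=3..Suc k. diagonal_gf j) =
      fps_X * diagonal_gf (Suc k) + fps_X * (\<Sum>j=3..k. diagonal_gf j)"
    by (simp add: algebra_simps)
  also have "\<dots> = diagonal_gf k - 1 - fps_X * C ^ Suc k"
    unfolding step.IH by simp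
  also have "\<dots> = diagonal_gf (Suc k) - 1 - fps_X * C ^ Suc (Suc k) - fps_X * diagonal_gf (Suc (Suc k))"
  proof -
    \<comment> \<open>This removes the truncated \<open>k - 1\<close>; \<open>C ^ l\<close> and
      \<open>l\<close> then act as indeterminates.\<close>
    obtain l where k: "k = Suc l" using step by (cases k) auto
    define y t where "y = C ^ l" and "t = (of_nat l :: real fps)"
    show ?thesis
      unfolding diagonal_gf_def k power_Suc diff_Suc_1 of_nat_Suc y_def[symmetric] t_def[symmetric]
      using quadratic inverse_root by algebra
  qed
  finally show ?case .
qed

text \<open>For \<open>h = 1\<close> the difference \<open>j - (k - 1)\<close> is 0 below
  \<open>k\<close> and 1 at \<open>k\<close>, so all terms but the last are pure powers.\<close>

lemma sum_state_gf:
  assumes "3 \<le> k"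
  shows "fps_X * (\<Sum>j=3..k. state_gf j (j - (k - 1)) False) =
    fps_X * (C ^ k + (C - 1) ^ 2 * i) + (1 - fps_X * C) * C ^ (k - 1) - C"
proof -
  define g where "g j = state_gf j (j - (k - 1)) False" for j
  have g: "g j = C ^ j" if "j \<in> {3..k-1}" for j
  proof -
    have "j - (k - 1) = 0" using that by simp
    then show ?thesis by (simp add: g_def state_gf_def)
  qed
  have "{3..k} = insert k {3..k-1}" using assms by auto
  then have "(\<Sum>j=3..k. g j) = g k + (\<Sum>j=3..k-1. g j)"
    using assms by simp
  also have "\<dots> = (C ^ k + (C - 1) ^ 2 * i) + (\<Sum>j=3..k-1. C ^ j)"
    using assms g by (simp add: g_def state_gf_def)
  finally show ?thesis
    using assms by (simp add: distrib_left sum_powers g_def)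
qed

text \<open>A set of states containing the root and closed under children, on which the closed forms
  are claimed; there \<open>h\<close> is 0, 1 or \<open>k - 1\<close>.\<close>

definition reachable :: "nat \<Rightarrow> nat \<Rightarrow> bool \<Rightarrow> bool" where
  "reachable k h f \<longleftrightarrow>
    (if f then 2 \<le> k \<and> Suc h = k \<or> 3 \<le> k \<and> h = 1
     else 2 \<le> k \<and> h = 0 \<or> 3 \<le> k \<and> (Suc h = k \<or> h = 1))"

lemma state_gf_rec:
  assumes "reachable k h f"
  shows "state_gf k h f = 1 + fps_X * (state_gf (Suc k) (of_bool f) f +
    state_gf (h + 2) (if Suc h = k then Suc h else h) f +
    (\<Sum>j=3..k. state_gf j (j - (k - h)) False))"
proof -
  \<comment> \<open>The value of \<open>h\<close> decides the shape of the sum: diagonal terms in A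
    and D, \<open>sum_state_gf\<close> in B and E, pure powers in C.\<close>
  consider (A) "f" "2 \<le> k" "Suc h = k" | (B) "f" "3 \<le> k" "h = 1"
    | (C) "\<not> f" "2 \<le> k" "h = 0" | (D) "\<not> f" "3 \<le> k" "Suc h = k"
    | (E) "\<not> f" "3 \<le> k" "h = 1"
    using assms by (auto simp: reachable_def split: if_splits)
  then have "state_gf k h f = 1 + (fps_X * state_gf (Suc k) (of_bool f) f +
    fps_X * state_gf (h + 2) (if Suc h = k then Suc h else h) f +
    fps_X * (\<Sum>j=3..k. state_gf j (j - (k - h)) False))"
  proof cases
    case A
    have "(\<Sum>j=3..k. state_gf j (j - (k - h)) False) = (\<Sum>j=3..k. diagonal_gf j)"
      using A by (intro sum.cong) (auto simp: state_gf_def)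
    then have S: "fps_X * (\<Sum>j=3..k. state_gf j (j - (k - h)) False) =
        diagonal_gf k - 1 - fps_X * C ^ Suc k - fps_X * diagonal_gf (Suc k)"
      using A by (simp add: sum_diagonal_gf)
    show ?thesis
      unfolding S using A by (simp add: state_gf_def) (simp add: algebra_simps)
  next
    case B
    obtain l where k: "k = Suc l" using B by (cases k) auto
    define y where "y = C ^ l"
    have S: "fps_X * (\<Sum>j=3..k. state_gf j (j - (k - h)) False) =
        fps_X * (C * y + (C - 1) ^ 2 * i) + (1 - fps_X * C) * y - C"
      using sum_state_gf[of k] B by (simp add: k y_def)
    \<comment> \<open>The leading children have \<open>(k, h)\<close> equal to
      \<open>(k + 1, 1)\<close> and \<open>(3, 1)\<close>, so their powers are
      \<open>C * (C * y)\<close> and \<open>C * (C * C)\<close>.\<close>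
    have "C * y + (1 - fps_X) * (C - 1) ^ 2 * i ^ 2 = 1 +
        (fps_X * (C * (C * y) + (1 - fps_X) * (C - 1) ^ 2 * i ^ 2) +
        fps_X * (C * (C * C) + (1 - fps_X) * (C - 1) ^ 2 * i ^ 2) +
        (fps_X * (C * y + (C - 1) ^ 2 * i) + (1 - fps_X * C) * y - C))"
      using quadratic inverse_two by algebra
    then show ?thesis
      unfolding S using B by (simp add: state_gf_def k flip: y_def)
  next
    case C
    have "(\<Sum>j=3..k. state_gf j (j - (k - h)) False) = (\<Sum>j=3..k. C ^ j)"
      using C by (intro sum.cong) (auto simp: state_gf_def)
    then have S: "fps_X * (\<Sum>j=3..k. state_gf j (j - (k - h)) False) =
        (1 - fps_X * C) * C ^ k - C"
      using C by (simp add: sum_powers)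
    define y where "y = C ^ k"
    have "y = 1 + (fps_X * (C * y) + fps_X * (C * C) + ((1 - fps_X * C) * y - C))"
      using quadratic by algebra
    then show ?thesis
      unfolding S using C by (simp add: state_gf_def flip: y_def)
  next
    case D
    have "(\<Sum>j=3..k. state_gf j (j - (k - h)) False) = (\<Sum>j=3..k. diagonal_gf j)"
      using D by (intro sum.cong) (auto simp: state_gf_def)
    then have S: "fps_X * (\<Sum>j=3..k. state_gf j (j - (k - h)) False) =
        diagonal_gf k - 1 - fps_X * C ^ Suc k - fps_X * diagonal_gf (Suc k)"
      using D by (simp add: sum_diagonal_gf)
    then show ?thesis
      unfolding S using D by (simp add: state_gf_def)
  next
    case E
    obtain l where k: "k = Suc l" using E by (cases k) auto
    define y where "y = C ^ l"
    have S: "fps_X * (\<Sum>j=3..k. state_gf j (j - (k - h)) False) =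
        fps_X * (C * y + (C - 1) ^ 2 * i) + (1 - fps_X * C) * y - C"
      using sum_state_gf[of k] E by (simp add: k y_def)
    have "C * y + (C - 1) ^ 2 * i = 1 +
        (fps_X * (C * (C * y)) + fps_X * (C * (C * C) + (C - 1) ^ 2 * i) +
        (fps_X * (C * y + (C - 1) ^ 2 * i) + (1 - fps_X * C) * y - C))"
      using quadratic inverse_two by algebra
    then show ?thesis
      unfolding S using E by (simp add: state_gf_def k flip: y_def)
  qed
  then show ?thesis by (simp only: distrib_left)
qed

lemma reachable_children:
  assumes "reachable k h f"
  shows "reachable (Suc k) (of_bool f) f"
    and "reachable (h + 2) (if Suc h = k then Suc h else h) f"
    and "j \<in> {3..k} \<Longrightarrow> reachable j (j - (k - h)) False"
  using assms by (auto simp: reachable_def split: if_splits)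

text \<open>The factor \<open>fps_X\<close> in \<open>state_gf_rec\<close> makes coefficient
  \<open>m + 1\<close> the sum of the children's coefficients at \<open>m\<close>, as in
  \<open>descendants\<close>.\<close>

lemma state_gf_nth:
  "reachable k h f \<Longrightarrow> fps_nth (state_gf k h f) m = of_nat (descendants m (k, h, f))"
proof (induction m arbitrary: k h f)
  case 0
  show ?case by (subst state_gf_rec[OF 0]) simp
next
  case (Suc m)
  note IH = Suc.IH[OF reachable_children(1)[OF Suc.prems]] Suc.IH[OF reachable_children(2)[OF Suc.prems]]
    Suc.IH[OF reachable_children(3)[OF Suc.prems]]
  show ?case
    by (subst state_gf_rec[OF Suc.prems]) (simp add: fps_sum_nth IH
        del: One_nat_def add_2_eq_Suc' split del: if_split)
qed

lemma avoiders_gf_eq: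
  "avoiders_gf patterns = C + fps_X * (C - 1) ^ 2 * (s + fps_X * i ^ 2)"
proof -
  have "reachable 2 1 True" by (simp add: reachable_def)
  \<comment> \<open>The root has length 1, hence the factor \<open>fps_X\<close>; the empty
    permutation contributes 1.\<close>
  have "avoiders_gf patterns = 1 + fps_X * state_gf 2 1 True"
  proof (intro fps_ext)
    fix n
    show "fps_nth (avoiders_gf patterns) n = fps_nth (1 + fps_X * state_gf 2 1 True) n"
      by (cases n) (simp_all add: avoiders_gf_def card_avoiders_0 card_avoiders_Suc
        state_gf_nth[OF \<open>reachable 2 1 True\<close>] del: One_nat_def)
  qed
  also have "\<dots> = C + fps_X * (C - 1) ^ 2 * (s + fps_X * i ^ 2)"
    using quadratic by (simp add: state_gf_def diagonal_gf_def) algebra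
  finally show ?thesis .
qed

end

theorem theorem3p40:
  fixes x C :: "real fps"
  defines "x \<equiv> fps_X" and "C \<equiv> catalan_gf"
  shows "avoiders_gf {[2,3,4,1], [1,2,4,3], [1,2,3,4]} =
    (x * (4*x^4 + 3*x^3 - 11*x^2 + 6*x - 1) * C + 2*x^4 - 12*x^3 + 16*x^2 - 7*x + 1)
    / ((1 - 2*x)^2 * (1 - 4*x + 2*x^2 - x * (1 - 3*x) * C))"
proof -
  define i s where "i = inverse (1 - 2 * x)" and "s = inverse (1 - 2 * x * C)"
  define F where "F = avoiders_gf {[2,3,4,1], [1,2,4,3], [1,2,3,4]}"
  define d where "d = (1 - 2*x)^2 * (1 - 4*x + 2*x^2 - x * (1 - 3*x) * C)"
  have quadratic: "x * C ^ 2 = C - 1"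
    unfolding x_def C_def by (rule catalan_gf_quadratic)
  have i: "i * (1 - 2 * x) = 1" and s: "s * (1 - 2 * x * C) = 1"
    unfolding i_def s_def x_def by (rule inverse_mult_eq_1, simp)+
  have "F = C + x * (C - 1) ^ 2 * (s + x * i ^ 2)"
    using quadratic i s unfolding F_def x_def by (rule avoiders_gf_eq)
  \<comment> \<open>Modulo \<open>quadratic\<close> the second factor of \<open>d\<close> is
    \<open>(1 - 2xC)(1 - 2x - x(1 - x)C)\<close>, so multiplying by \<open>d\<close> clears both
    \<open>s\<close> and \<open>i ^ 2\<close>.\<close>
  then have "F * d =
      x * (4*x^4 + 3*x^3 - 11*x^2 + 6*x - 1) * C + 2*x^4 - 12*x^3 + 16*x^2 - 7*x + 1"
    unfolding d_def using quadratic i s by algebra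
  moreover have "fps_nth d 0 = 1"
    by (simp add: d_def x_def power2_eq_square)
  then have "d \<noteq> 0" by auto
  ultimately show ?thesis
    unfolding F_def[symmetric] d_def[symmetric] by (metis nonzero_mult_div_cancel_right)
qed

end
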